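(* Let $(X,d)$ be a complete $\mathrm{CAT}(0)$ space. If $S\subseteq X$ is convex then $\operatorname{thr}S=S$. In general, for any set $S\subseteq X$, $$\bigcup_{n\in\mathbb N}\operatorname{thr}^nS=\operatorname{co}S .$$
   Context: A $\mathrm{CAT}(0)$ space is a geodesic metric space in which every geodesic triangle is at least as thin as its Euclidean comparison triangle; it is uniquely geodesic, and $[x,y]$ denotes the geodesic segment joining $x$ and $y$. A set $C\subseteq X$ is convex if $[x,y]\subseteq C$ for all $x,y\in C$; $\operatorname{co}S$ is the smallest convex set containing $S$. The threading of $S\subseteq X$ is $\operatorname{thr}S:=\bigcup_{x,y\in S}[x,y]$, and iteratively $\operatorname{thr}^1S=\operatorname{thr}S$, $\operatorname{thr}^nS=\operatorname{thr}(\operatorname{thr}^{n-1}S)$; $\mathbb N=\{1,2,\dots\}$. *)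

theory Defs
  imports "HOL-Analysis.Analysis"
begin

context Metric_space
begin

definition geodesic_path :: "(real \<Rightarrow> 'a) \<Rightarrow> real \<Rightarrow> 'a \<Rightarrow> 'a \<Rightarrow> bool" where
  "geodesic_path c l x y \<longleftrightarrow>
     0 \<le> l \<and> c ` {0..l} \<subseteq> M \<and> c 0 = x \<and> c l = y \<and>
     (\<forall>s\<in>{0..l}. \<forall>t\<in>{0..l}. d (c s) (c t) = \<bar>s - t\<bar>)"

definition geodesic_segment :: "'a set \<Rightarrow> 'a \<Rightarrow> 'a \<Rightarrow> bool" where
  "geodesic_segment G x y \<longleftrightarrow> (\<exists>c l. geodesic_path c l x y \<and> G = c ` {0..l})"

definition geodesic_space :: bool where
  "geodesic_space \<longleftrightarrow> (\<forall>x\<in>M. \<forall>y\<in>M. \<exists>G. geodesic_segment G x y)"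

definition geodesic_triangle ::
    "'a \<Rightarrow> 'a \<Rightarrow> 'a \<Rightarrow> 'a set \<Rightarrow> 'a set \<Rightarrow> 'a set \<Rightarrow> bool" where
  "geodesic_triangle p q r A B C \<longleftrightarrow>
     geodesic_segment A p q \<and> geodesic_segment B q r \<and> geodesic_segment C r p"

definition comparison_triangle ::
    "'a \<Rightarrow> 'a \<Rightarrow> 'a \<Rightarrow> real^2 \<Rightarrow> real^2 \<Rightarrow> real^2 \<Rightarrow> bool" where
  "comparison_triangle p q r p' q' r' \<longleftrightarrow>
     dist p' q' = d p q \<and> dist q' r' = d q r \<and> dist r' p' = d r p"

text \<open>Pairs of a point on a side \<open>A\<close> from \<open>p\<close> to \<open>q\<close> and its comparison point
  on the Euclidean side from \<open>p'\<close> to \<open>q'\<close>.\<close>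

definition comparison_points ::
    "'a set \<Rightarrow> 'a \<Rightarrow> 'a \<Rightarrow> real^2 \<Rightarrow> real^2 \<Rightarrow> ('a \<times> (real^2)) set" where
  "comparison_points A p q p' q' =
     {(x, x'). x \<in> A \<and> x' \<in> closed_segment p' q' \<and>
               dist p' x' = d p x \<and> dist x' q' = d x q}"

text \<open>Comparison triangles always exist and are unique up to isometry of the plane,
  so quantifying universally over them loses nothing.\<close>

definition CAT0 :: bool where
  "CAT0 \<longleftrightarrow> geodesic_space \<and>
     (\<forall>p q r A B C p' q' r'.
        geodesic_triangle p q r A B C \<longrightarrow> comparison_triangle p q r p' q' r' \<longrightarrow>
        (let K = comparison_points A p q p' q' \<union> comparison_points B q r q' r' \<union>
                 comparison_points C r p r' p'
         in \<forall>(x, x')\<in>K. \<forall>(y, y')\<in>K. d x y \<le> dist x' y'))"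

text \<open>The description operator is meaningful only when geodesic segments are unique,
  as they are in \<open>CAT(0)\<close> spaces.\<close>

definition geod :: "'a \<Rightarrow> 'a \<Rightarrow> 'a set" where
  "geod x y = (THE G. geodesic_segment G x y)"

definition geod_convex :: "'a set \<Rightarrow> bool" where
  "geod_convex C \<longleftrightarrow> C \<subseteq> M \<and> (\<forall>x\<in>C. \<forall>y\<in>C. geod x y \<subseteq> C)"

definition co :: "'a set \<Rightarrow> 'a set" where
  "co S = geod_convex hull S"

definition thr :: "'a set \<Rightarrow> 'a set" where
  "thr S = (\<Union>x\<in>S. \<Union>y\<in>S. geod x y)"

end

locale complete_CAT0_space = Metric_space +
  assumes mcomplete: "mcomplete"
    and CAT0: "CAT0"

end

theory Submission
  imports Defs
begin

context Metric_space
begin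

text \<open>The CAT(0) inequality forces geodesics with common endpoints to coincide
  (\<open>geodesic_path_unique\<close>), so \<open>geod x y\<close> is a genuine segment
  (\<open>geodesic_segment_geod\<close>). What remains is a closure argument. A convex set
  containing \<open>S\<close> absorbs \<open>thr S\<close>, hence every iterate
  (\<open>thr_iter_subset_convex\<close>), so the union lies in \<open>co S\<close>. Degenerate
  segments give \<open>S \<subseteq> thr S\<close> (\<open>subset_thr\<close>), which settles the
  convex case and makes the iterates increase. Two points of the union therefore share an iterate,
  and their segment lies in the next one, so the union is convex and contains the hull.\<close>

lemma geodesic_path_length:
  assumes "geodesic_path c l x y"
  shows "d x y = l"
proof -
  have "d (c 0) (c l) = \<bar>0 - l\<bar>"
    using assms unfolding geodesic_path_def by (meson atLeastAtMost_iff order_refl)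
  then show ?thesis
    using assms unfolding geodesic_path_def by auto
qed

lemma geodesic_path_dist_endpoints:
  assumes "geodesic_path c l x y" and "t \<in> {0..l}"
  shows "d x (c t) = t" and "d (c t) y = l - t"
proof -
  have "d (c 0) (c t) = \<bar>0 - t\<bar>" "d (c t) (c l) = \<bar>t - l\<bar>"
    using assms unfolding geodesic_path_def by (meson atLeastAtMost_iff order_refl)+
  then show "d x (c t) = t" and "d (c t) y = l - t"
    using assms unfolding geodesic_path_def by auto
qed

lemma geodesic_path_reverse:
  assumes "geodesic_path c l x y"
  shows "geodesic_path (\<lambda>t. c (l - t)) l y x"
  using assms unfolding geodesic_path_def by (auto simp: image_subset_iff)

text \<open>Sides of a triangle are oriented cyclically, so a second geodesic from \<open>x\<close>
  to \<open>y\<close> can serve as the closing side only after reversal.\<close>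

lemma geodesic_segment_sym:
  assumes "geodesic_segment G x y"
  shows "geodesic_segment G y x"
proof -
  obtain c l where c: "geodesic_path c l x y" and G: "G = c ` {0..l}"
    using assms unfolding geodesic_segment_def by blast
  have "(\<lambda>t. c (l - t)) ` {0..l} = c ` ((\<lambda>t. l - t) ` {0..l})"
    by (simp only: image_image)
  also have "(\<lambda>t. l - t) ` {0..l} = {0..l}"
    by simp
  finally show ?thesis
    using geodesic_path_reverse[OF c] G unfolding geodesic_segment_def by metis
qed

text \<open>Supplies the degenerate side of the triangle used for uniqueness.\<close>

lemma geodesic_segment_refl:
  assumes "x \<in> M"
  shows "geodesic_segment {x} x x"
  unfolding geodesic_segment_def geodesic_path_def
  by (rule exI[of _ "\<lambda>_. x"], rule exI[of _ 0]) (use assms in auto)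

lemma geodesic_segment_subset: "geodesic_segment G x y \<Longrightarrow> G \<subseteq> M"
  unfolding geodesic_segment_def geodesic_path_def by blast

lemma geodesic_segment_endpoint: "geodesic_segment G x y \<Longrightarrow> x \<in> G"
  unfolding geodesic_segment_def geodesic_path_def by force

lemma CAT0_dist_le:
  assumes "CAT0" and "geodesic_triangle p q r A B C" and "comparison_triangle p q r p' q' r'"
    and "(x, x') \<in> comparison_points A p q p' q' \<union> comparison_points B q r q' r' \<union>
      comparison_points C r p r' p'"
    and "(y, y') \<in> comparison_points A p q p' q' \<union> comparison_points B q r q' r' \<union>
      comparison_points C r p r' p'"
  shows "d x y \<le> dist x' y'"
proof -
  let ?K = "comparison_points A p q p' q' \<union> comparison_points B q r q' r' \<union>
      comparison_points C r p r' p'"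
  have "\<forall>(x, x')\<in>?K. \<forall>(y, y')\<in>?K. d x y \<le> dist x' y'"
    using assms(1-3) unfolding CAT0_def Let_def by simp
  from bspec[OF this assms(4), unfolded prod.case] show ?thesis
    using assms(5) by (auto dest: bspec)
qed

text \<open>Two geodesics from \<open>x\<close> to \<open>y\<close> are the sides of a triangle with vertices \<open>x\<close>, \<open>y\<close>, \<open>y\<close>,
  whose comparison triangle is a segment.\<close>

lemma geodesic_path_unique:
  assumes "CAT0" and c: "geodesic_path c l x y" and c': "geodesic_path c' l x y"
    and t: "t \<in> {0..l}"
  shows "c t = c' t"
proof -
  have M: "x \<in> M" "y \<in> M" "c t \<in> M" "c' t \<in> M" and l: "0 \<le> l"
    using c c' t unfolding geodesic_path_def by (auto simp: image_subset_iff)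
  have dist: "d x (c t) = t" "d (c t) y = l - t" "d x (c' t) = t" "d (c' t) y = l - t" "d x y = l"
    using geodesic_path_dist_endpoints[OF c t] geodesic_path_dist_endpoints[OF c' t]
      geodesic_path_length[OF c] by blast+
  \<comment> \<open>Any unit vector would do: the degenerate comparison triangle is placed on the
    line it spans, where distances are differences of parameters.\<close>
  define u :: "real^2" where "u = axis 1 1"
  have u: "norm u = 1"
    by (simp add: u_def)
  have dist_u: "dist (a *\<^sub>R u) (b *\<^sub>R u) = \<bar>a - b\<bar>" for a b
    by (simp add: dist_norm u flip: scaleR_diff_left)
  have seg: "t *\<^sub>R u \<in> closed_segment (0 *\<^sub>R u) (l *\<^sub>R u)"
  \<comment> \<open>The convex coefficient is \<open>t / l\<close>, so a constant path is treated
    apart.\<close>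
  proof (cases "l = 0")
    case False
    then show ?thesis
      using t by (auto simp: in_segment intro!: exI[of _ "t / l"])
  qed (use t in auto)
  let ?G = "c ` {0..l}" and ?H = "c' ` {0..l}"
  have "geodesic_segment ?G x y" "geodesic_segment ?H y x" "geodesic_segment {y} y y"
    using c c' M geodesic_segment_refl geodesic_segment_sym
    unfolding geodesic_segment_def by blast+
  then have triangle: "geodesic_triangle x y y ?G {y} ?H"
    unfolding geodesic_triangle_def by blast
  \<comment> \<open>The origin is kept as \<open>0 *\<^sub>R u\<close> so that \<open>dist_u\<close>
    evaluates every distance.\<close>
  have comparison: "comparison_triangle x y y (0 *\<^sub>R u) (l *\<^sub>R u) (l *\<^sub>R u)"
    unfolding comparison_triangle_def dist_u using dist l M by (simp add: commute)
  have "(c t, t *\<^sub>R u) \<in> comparison_points ?G x y (0 *\<^sub>R u) (l *\<^sub>R u)"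
    unfolding comparison_points_def mem_Collect_eq prod.case dist_u
    using seg t dist by auto
  moreover have "(c' t, t *\<^sub>R u) \<in> comparison_points ?H y x (l *\<^sub>R u) (0 *\<^sub>R u)"
    unfolding comparison_points_def mem_Collect_eq prod.case dist_u
    using seg t dist by (auto simp: commute closed_segment_commute)
  \<comment> \<open>Both points lie at distance \<open>t\<close> from \<open>x\<close>, so they
    share a comparison point and the bound is zero.\<close>
  ultimately have "d (c t) (c' t) \<le> dist (t *\<^sub>R u) (t *\<^sub>R u)"
    using CAT0_dist_le[OF \<open>CAT0\<close> triangle comparison] by blast
  then show ?thesis
    using M by (metis dist_self mdist_pos_less not_less)
qed

lemma geodesic_segment_unique:
  assumes "CAT0" and G: "geodesic_segment G x y" and H: "geodesic_segment H x y"
  shows "G = H"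
proof -
  obtain c l c' l' where c: "geodesic_path c l x y" "G = c ` {0..l}"
      and c': "geodesic_path c' l' x y" "H = c' ` {0..l'}"
    using G H unfolding geodesic_segment_def by blast
  \<comment> \<open>Both lengths equal \<open>d x y\<close>, so the two paths have the same
    domain.\<close>
  moreover have "l' = l"
    using c(1) c'(1) geodesic_path_length by metis
  ultimately show ?thesis
    using geodesic_path_unique[OF \<open>CAT0\<close>] by (metis image_cong)
qed

lemma geod_eq:
  assumes "CAT0" and "geodesic_segment G x y"
  shows "geod x y = G"
  unfolding geod_def
  using assms(2) geodesic_segment_unique[OF assms(1) _ assms(2)] by (rule the_equality)

lemma geodesic_segment_geod:
  assumes "CAT0" and "x \<in> M" and "y \<in> M"
  shows "geodesic_segment (geod x y) x y"
proof -
  obtain G where "geodesic_segment G x y"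
    using assms unfolding CAT0_def geodesic_space_def by blast
  then show ?thesis
    using geod_eq[OF assms(1)] by simp
qed

text \<open>With the whole space as the convex set, the absorption lemma keeps all iterates inside
  \<open>M\<close>.\<close>

lemma geod_convex_carrier:
  assumes "CAT0"
  shows "geod_convex M"
  unfolding geod_convex_def
  using geodesic_segment_subset[OF geodesic_segment_geod[OF assms]] by simp

lemma subset_thr:
  assumes "CAT0" and "S \<subseteq> M"
  shows "S \<subseteq> thr S"
proof
  fix x
  assume "x \<in> S"
  moreover from this have "x \<in> geod x x"
    using geodesic_segment_endpoint[OF geodesic_segment_geod[OF assms(1)]] assms(2) by blast
  ultimately show "x \<in> thr S"
    unfolding thr_def by blast
qed

lemma thr_subset_convex:
  assumes "geod_convex C" and "S \<subseteq> C"
  shows "thr S \<subseteq> C"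
  using assms unfolding geod_convex_def thr_def by blast

lemma thr_convex:
  assumes "CAT0" and "geod_convex S"
  shows "thr S = S"
  using assms subset_thr thr_subset_convex unfolding geod_convex_def by blast

lemma thr_iter_subset_convex:
  assumes "geod_convex C" and "S \<subseteq> C"
  shows "(thr ^^ n) S \<subseteq> C"
  by (induction n) (use assms thr_subset_convex in auto)

lemma thr_iter_mono:
  assumes "CAT0" and "S \<subseteq> M" and "m \<le> n"
  shows "(thr ^^ m) S \<subseteq> (thr ^^ n) S"
  using \<open>m \<le> n\<close>
\<comment> \<open>It suffices to compare consecutive iterates.\<close>
proof (rule lift_Suc_mono_le[rotated])
  fix k
  have "(thr ^^ k) S \<subseteq> M"
    using thr_iter_subset_convex geod_convex_carrier assms by blast
  then show "(thr ^^ k) S \<subseteq> (thr ^^ Suc k) S"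
    using subset_thr assms by simp
qed

lemma geod_convex_Union_thr:
  assumes "CAT0" and "S \<subseteq> M"
  shows "geod_convex (\<Union>n\<in>{1..}. (thr ^^ n) S)"
  unfolding geod_convex_def
proof (intro conjI ballI)
  show "(\<Union>n\<in>{1..}. (thr ^^ n) S) \<subseteq> M"
    using thr_iter_subset_convex geod_convex_carrier assms by blast
next
  fix x y
  assume "x \<in> (\<Union>n\<in>{1..}. (thr ^^ n) S)" and "y \<in> (\<Union>n\<in>{1..}. (thr ^^ n) S)"
  then obtain m n where "x \<in> (thr ^^ m) S" and "y \<in> (thr ^^ n) S"
    by blast
  \<comment> \<open>Monotonicity brings both points to a common stage; one more threading adds their
    segment.\<close>
  then have "x \<in> (thr ^^ max m n) S" and "y \<in> (thr ^^ max m n) S"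
    using thr_iter_mono[OF assms] by (meson max.cobounded1 max.cobounded2 subsetD)+
  then have "geod x y \<subseteq> (thr ^^ Suc (max m n)) S"
    by (auto simp: thr_def)
  then show "geod x y \<subseteq> (\<Union>n\<in>{1..}. (thr ^^ n) S)"
    by (rule order_trans) (rule UN_upper, simp)
qed

lemma Union_thr_eq_co:
  assumes "CAT0" and "S \<subseteq> M"
  shows "(\<Union>n\<in>{1..}. (thr ^^ n) S) = co S"
proof
  show "(\<Union>n\<in>{1..}. (thr ^^ n) S) \<subseteq> co S"
    unfolding co_def hull_def using thr_iter_subset_convex by blast
  \<comment> \<open>The union starts at exponent 1, so \<open>S\<close> itself is not one of its
    terms and is recovered from the first threading.\<close>
  have "S \<subseteq> (thr ^^ 1) S"
    using subset_thr assms by simp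
  then have "S \<subseteq> (\<Union>n\<in>{1..}. (thr ^^ n) S)"
    by blast
  then show "co S \<subseteq> (\<Union>n\<in>{1..}. (thr ^^ n) S)"
    unfolding co_def by (rule hull_minimal) (rule geod_convex_Union_thr[OF assms])
qed

end

theorem theorem3:
  fixes M :: "'a set" and d :: "'a \<Rightarrow> 'a \<Rightarrow> real" and S :: "'a set"
  assumes "complete_CAT0_space M d"
    and "S \<subseteq> M"
  shows "(Metric_space.geod_convex M d S \<longrightarrow> Metric_space.thr M d S = S) \<and>
         (\<Union>n\<in>{1..}. (Metric_space.thr M d ^^ n) S) = Metric_space.co M d S"
proof -
  interpret complete_CAT0_space M d
    by (rule assms(1))
  show ?thesis
    using thr_convex[OF CAT0] Union_thr_eq_co[OF CAT0 assms(2)] by blast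
qed

end
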